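(* Let $K\ge 2$, $a\ge 1$, $b\ge 1$ be integers, let $N=K(a+b)$, and consider the $(K,a,b)$ coded caching problem for location-based content with cache size $M$, $0\le M\le 2a+b$. Let $R^\star_{\rm u}$ denote its optimal worst-case load under uncoded cache placement. (i) If $b(K-1)<2a$, then $$R^\star_{\rm u}=\begin{cases} K-\dfrac{K+1}{2(a+b)}M, & 0\le M\le a+b,\\[2mm] \dfrac{(K-1)(2a+b)}{2a}-\dfrac{K-1}{2a}M, & a+b< M\le 2a+b.\end{cases}$$ (ii) If $b(K-1)\ge 2a$, then $R^\star_{\rm u}=K-\dfrac{K}{2a+b}M$.
   Context: For integers $x\le y$, $[x:y]=\{x,x+1,\dots,y\}$ and $[n]=[1:n]$. For integers $c$ and $m\ge1$, $\langle c\rangle_m$ denotes the unique element of $\{1,\dots,m\}$ congruent to $c$ modulo $m$. The $(K,a,b)$ coded caching problem for location-based content: a server has $N=K(a+b)$ files $W_1,\dots,W_N$, each consisting of $B$ independent uniformly distributed bits (any subpacketization of files is allowed). There are $K$ cache nodes, each storing $MB$ bits, and $K$ users, user $k$ having free access to cache node $k$ only. For $k\in[K]$ define $\mathcal D_{k,1}=[(k-1)(a+b)+1:ka+(k-1)b]$, $\mathcal D_{k,2}=[ka+(k-1)b+1:k(a+b)]$, $\mathcal D_{k,3}=\mathcal D_{\langle k+1\rangle_K,1}$, and $\mathcal D_k=\mathcal D_{k,1}\cup\mathcal D_{k,2}\cup\mathcal D_{k,3}$ (so $|\mathcal D_{k,1}|=|\mathcal D_{k,3}|=a$, $|\mathcal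 D_{k,2}|=b$). A scheme consists of: placement functions $Z_k=\phi_k(W_1,\dots,W_N)\in\{0,1\}^{MB}$ for $k\in[K]$, chosen without knowledge of demands; for every demand vector $\mathbf d=(d_1,\dots,d_K)\in\mathcal D_1\times\cdots\times\mathcal D_K$, a transmitted message $X=\psi(\mathbf d,W_1,\dots,W_N)\in\{0,1\}^{RB}$ broadcast to all users; and decoding functions such that, for every such $\mathbf d$ and every $k$, user $k$ recovers $W_{d_k}$ exactly from $(\mathbf d,Z_k,X)$. The number $R$ is the (worst-case) load of the scheme. The optimal load $R^\star$ is the infimum of $R$ over all schemes (and all $B$). The placement is uncoded if each $Z_k$ consists of a subset of the bits of the files copied directly; $R^\star_{\rm u}$ is the infimum of loads over schemes with uncoded placement. *)

theory Defs
  imports Complex_Main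
begin

definition cyc :: "int \<Rightarrow> int \<Rightarrow> int" where
  "cyc c m = (c - 1) mod m + 1"

definition Dset1 :: "nat \<Rightarrow> nat \<Rightarrow> nat \<Rightarrow> nat set" where
  "Dset1 a b k = {(k - 1) * (a + b) + 1 .. k * a + (k - 1) * b}"

definition Dset2 :: "nat \<Rightarrow> nat \<Rightarrow> nat \<Rightarrow> nat set" where
  "Dset2 a b k = {k * a + (k - 1) * b + 1 .. k * (a + b)}"

definition Dset3 :: "nat \<Rightarrow> nat \<Rightarrow> nat \<Rightarrow> nat \<Rightarrow> nat set" where
  "Dset3 K a b k = Dset1 a b (nat (cyc (int k + 1) (int K)))"

definition Dset :: "nat \<Rightarrow> nat \<Rightarrow> nat \<Rightarrow> nat \<Rightarrow> nat set" where
  "Dset K a b k = Dset1 a b k \<union> Dset2 a b k \<union> Dset3 K a b k"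

definition valid_demand :: "nat \<Rightarrow> nat \<Rightarrow> nat \<Rightarrow> (nat \<Rightarrow> nat) \<Rightarrow> bool" where
  "valid_demand K a b d \<longleftrightarrow> (\<forall>k\<in>{1..K}. d k \<in> Dset K a b k)"

text \<open>A file library with N files of B bits each: W i j is bit j of file i;
  the function is fixed to False outside the index range {1..N} x {0..<B}.\<close>
definition valid_library :: "nat \<Rightarrow> nat \<Rightarrow> (nat \<Rightarrow> nat \<Rightarrow> bool) \<Rightarrow> bool" where
  "valid_library N B W \<longleftrightarrow> (\<forall>i j. (i \<notin> {1..N} \<or> B \<le> j) \<longrightarrow> W i j = False)"

text \<open>Content of an uncoded cache storing exactly the bits in S (a set of
  (file, bit) positions): the copied bits; all other positions are blanked.\<close>
definition cache_content :: "(nat \<times> nat) set \<Rightarrow> (nat \<Rightarrow> nat \<Rightarrow> bool) \<Rightarrow> (nat \<times> nat \<Rightarrow> bool)" where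
  "cache_content S W = (\<lambda>p. if p \<in> S then W (fst p) (snd p) else False)"

text \<open>R is the load of some scheme with uncoded placement for the (K,a,b)
  problem with cache size M: files of B \<ge> 1 bits, each cache k stores a set
  S k of at most M B file bits (chosen independently of the demand), the
  server broadcasts L = R B bits depending on the demand and the files, and
  every user k decodes its demanded file from (d, Z_k, X).\<close>
definition achievable_u :: "nat \<Rightarrow> nat \<Rightarrow> nat \<Rightarrow> real \<Rightarrow> real \<Rightarrow> bool" where
  "achievable_u K a b M R \<longleftrightarrow>
     (\<exists>(B::nat) (L::nat) (S :: nat \<Rightarrow> (nat \<times> nat) set)
        (X :: (nat \<Rightarrow> nat) \<Rightarrow> (nat \<Rightarrow> nat \<Rightarrow> bool) \<Rightarrow> bool list)
        (dec :: nat \<Rightarrow> (nat \<Rightarrow> nat) \<Rightarrow> (nat \<times> nat \<Rightarrow> bool) \<Rightarrow> bool list \<Rightarrow> (nat \<Rightarrow> bool)).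
        B \<ge> 1 \<and> R = real L / real B \<and>
        (\<forall>k\<in>{1..K}. S k \<subseteq> {1..K * (a + b)} \<times> {..<B} \<and> real (card (S k)) \<le> M * real B) \<and>
        (\<forall>d W. valid_demand K a b d \<longrightarrow> valid_library (K * (a + b)) B W \<longrightarrow>
            length (X d W) = L \<and>
            (\<forall>k\<in>{1..K}. dec k d (cache_content (S k) W) (X d W) = W (d k))))"

definition Rstar_u :: "nat \<Rightarrow> nat \<Rightarrow> nat \<Rightarrow> real \<Rightarrow> real" where
  "Rstar_u K a b M = Inf {R. achievable_u K a b M R}"

end

theory Submission
  imports Defs
begin

text \<open>Converse: fix an order of the users and distinct demands. The bits of each demanded file
  that are cached neither by its user nor by an earlier one must all be carried by the message.
  Averaged over cyclic orders in both directions, this bounds the load in terms of the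
  average number \<open>c\<close> of cached copies of a common file and \<open>p\<close> of a private file, with
  \<open>a * c + b * p \<le> M\<close> (see \<open>load_bounds\<close>); suitable convex combinations of these bounds are tight.

  Achievability: time-share between no caching, caching everything a user may ask for, and caching
  the private files together with complementary halves of each common file. In the last case each
  missing half is known to a neighbour. Following "who knows my missing half" through the users
  leads into a cycle; on this cycle the server sends only differences of halves, which saves one
  half-file.\<close>

section \<open>Cyclic neighbours of users and coordinates for the files\<close>

definition succ_user :: "nat \<Rightarrow> nat \<Rightarrow> nat" where
  "succ_user K k = (if k = K then 1 else k + 1)"

definition pred_user :: "nat \<Rightarrow> nat \<Rightarrow> nat" where
  "pred_user K k = (if k = 1 then K else k - 1)"

lemma succ_user_in: "k \<in> {1..K} \<Longrightarrow> succ_user K k \<in> {1..K}"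
  by (auto simp: succ_user_def)

lemma pred_user_in: "k \<in> {1..K} \<Longrightarrow> pred_user K k \<in> {1..K}"
  by (auto simp: pred_user_def)

lemma succ_pred_user: "k \<in> {1..K} \<Longrightarrow> succ_user K (pred_user K k) = k"
  by (auto simp: succ_user_def pred_user_def)

lemma pred_succ_user: "k \<in> {1..K} \<Longrightarrow> pred_user K (succ_user K k) = k"
  by (auto simp: succ_user_def pred_user_def)

lemma bij_betw_pred_user: "bij_betw (pred_user K) {1..K} {1..K}"
  by (rule bij_betw_byWitness[where f' = "succ_user K"])
     (use succ_user_in pred_user_in succ_pred_user pred_succ_user in blast)+

lemma Dset3_succ_user:
  assumes "k \<in> {1..K}"
  shows "Dset3 K a b k = Dset1 a b (succ_user K k)"
proof (cases "k = K")
  case True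
  then show ?thesis using assms by (simp add: Dset3_def cyc_def succ_user_def)
next
  case False
  then have "int k mod int K = int k" using assms by simp
  then show ?thesis using False by (simp add: Dset3_def cyc_def succ_user_def nat_add_distrib)
qed

lemma Dset3_pred_user:
  assumes "k \<in> {1..K}"
  shows "Dset3 K a b (pred_user K k) = Dset1 a b k"
  using Dset3_succ_user[OF pred_user_in[OF assms]] succ_pred_user[OF assms] by simp

text \<open>With \<open>m = a + b\<close>, the files \<open>t < a\<close> of block \<open>k\<close> are common to user \<open>k\<close> and its
  predecessor, the files \<open>a \<le> t < a + b\<close> are private to user \<open>k\<close>.\<close>
definition file_ix :: "nat \<Rightarrow> nat \<Rightarrow> nat \<Rightarrow> nat" where
  "file_ix m k t = (k - 1) * m + 1 + t"

lemma inj_on_file_ix: "inj_on (\<lambda>(k, t). file_ix m k t) ({1..K} \<times> {..<m})"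
proof (rule inj_onI, clarify)
  fix k t k' t'
  assume kt: "k \<in> {1..K}" "t < m" "k' \<in> {1..K}" "t' < m"
    and eq: "file_ix m k t = file_ix m k' t'"
  from eq have "(k - 1) * m + t = (k' - 1) * m + t'" by (simp add: file_ix_def)
  then have "((k - 1) * m + t) div m = ((k' - 1) * m + t') div m"
    and "((k - 1) * m + t) mod m = ((k' - 1) * m + t') mod m" by simp_all
  then show "k = k' \<and> t = t'" using kt by auto
qed

lemma file_ix_eq_iff:
  assumes "k \<in> {1..K}" "k' \<in> {1..K}" "t < m" "t' < m"
  shows "file_ix m k t = file_ix m k' t' \<longleftrightarrow> k = k' \<and> t = t'"
  using inj_on_eq_iff[OF inj_on_file_ix, of "(k, t)" K m "(k', t')"] assms by auto

lemma mem_Dset1: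
  assumes "k \<ge> 1" "t < a" shows "file_ix (a + b) k t \<in> Dset1 a b k"
proof -
  obtain k' where "k = Suc k'" using assms by (cases k) auto
  then show ?thesis using assms by (auto simp: Dset1_def file_ix_def algebra_simps)
qed

lemma mem_Dset2:
  assumes "k \<ge> 1" "t < b" shows "file_ix (a + b) k (a + t) \<in> Dset2 a b k"
proof -
  obtain k' where "k = Suc k'" using assms by (cases k) auto
  then show ?thesis using assms by (auto simp: Dset2_def file_ix_def algebra_simps)
qed

lemma Dset12_subset:
  assumes "k \<in> {1..K}"
  shows "Dset1 a b k \<union> Dset2 a b k \<subseteq> {1..K * (a + b)}"
proof -
  have "k * (a + b) \<le> K * (a + b)" using assms by (intro mult_le_mono1) simp
  moreover have "k * a + (k - 1) * b \<le> k * (a + b)"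
    by (simp add: algebra_simps)
  ultimately show ?thesis
    by (auto simp: Dset1_def Dset2_def algebra_simps)
qed

lemma Dset_subset:
  assumes "k \<in> {1..K}"
  shows "Dset K a b k \<subseteq> {1..K * (a + b)}"
  using Dset12_subset[OF assms, of a b] Dset12_subset[OF succ_user_in[OF assms], of a b]
  by (auto simp: Dset_def Dset3_succ_user[OF assms])

lemma card_Dset1: "k \<ge> 1 \<Longrightarrow> card (Dset1 a b k) = a"
  by (cases k) (auto simp: Dset1_def algebra_simps)

lemma card_Dset2: "k \<ge> 1 \<Longrightarrow> card (Dset2 a b k) = b"
  by (cases k) (auto simp: Dset2_def algebra_simps)

lemma card_Dset3: "k \<in> {1..K} \<Longrightarrow> card (Dset3 K a b k) = a"
  using succ_user_in[of k K] by (simp add: Dset3_succ_user card_Dset1)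

lemma finite_Dsets: "finite (Dset1 a b k)" "finite (Dset2 a b k)" "finite (Dset3 K a b k)"
  by (auto simp: Dset1_def Dset2_def Dset3_def)

section \<open>Converse\<close>

locale uncoded_scheme =
  fixes K a b B L :: nat and M :: real
    and S :: "nat \<Rightarrow> (nat \<times> nat) set"
    and X :: "(nat \<Rightarrow> nat) \<Rightarrow> (nat \<Rightarrow> nat \<Rightarrow> bool) \<Rightarrow> bool list"
    and dec :: "nat \<Rightarrow> (nat \<Rightarrow> nat) \<Rightarrow> (nat \<times> nat \<Rightarrow> bool) \<Rightarrow> bool list \<Rightarrow> (nat \<Rightarrow> bool)"
  assumes K2: "K \<ge> 2" and a1: "a \<ge> 1" and b1: "b \<ge> 1" and B1: "B \<ge> 1"
    and S_sub: "\<And>k. k \<in> {1..K} \<Longrightarrow> S k \<subseteq> {1..K * (a + b)} \<times> {..<B}"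
    and S_card: "\<And>k. k \<in> {1..K} \<Longrightarrow> real (card (S k)) \<le> M * real B"
    and len_X: "\<And>d W. valid_demand K a b d \<Longrightarrow> valid_library (K * (a + b)) B W \<Longrightarrow> length (X d W) = L"
    and decodes: "\<And>d W k. valid_demand K a b d \<Longrightarrow> valid_library (K * (a + b)) B W \<Longrightarrow> k \<in> {1..K} \<Longrightarrow>
        dec k d (cache_content (S k) W) (X d W) = W (d k)"
begin

definition cached :: "nat \<Rightarrow> nat \<Rightarrow> real" where
  "cached l n = real (card {j. j < B \<and> (n, j) \<in> S l})"

definition copies :: "nat \<Rightarrow> real" where
  "copies n = (\<Sum>l\<in>{1..K}. cached l n)"

text \<open>Vary only the bits of the demanded files that are cached neither by their user nor by
  a user of smaller or equal rank. The decoders, run in order of rank, recover all of them from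
  the message alone.\<close>
lemma index_coding_bound:
  fixes rk :: "nat \<Rightarrow> int"
  assumes d: "valid_demand K a b d" and inj: "inj_on d {1..K}"
  shows "(\<Sum>k\<in>{1..K}. max 0 (real B - (\<Sum>l\<in>{l\<in>{1..K}. rk l \<le> rk k}. cached l (d k)))) \<le> real L"
proof -
  define G where "G k = {j. j < B \<and> (\<forall>l\<in>{1..K}. rk l \<le> rk k \<longrightarrow> (d k, j) \<notin> S l)}" for k
  define T where "T = (\<Union>k\<in>{1..K}. {d k} \<times> G k)"
  \<comment> \<open>Every bit outside \<open>T\<close> is held at \<open>False\<close>, so a subset
    of \<open>T\<close> encodes the whole library.\<close>
  define lib where "lib U = (\<lambda>n j. (n, j) \<in> U)" for U :: "(nat \<times> nat) set"
  have finG: "finite (G k)" for k by (simp add: G_def)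
  then have finT: "finite T" by (simp add: T_def)
  have dN: "d k \<in> {1..K * (a + b)}" if "k \<in> {1..K}" for k
    using d subsetD[OF Dset_subset[OF that]] that by (simp only: valid_demand_def)
  have valid: "valid_library (K * (a + b)) B (lib U)" if "U \<subseteq> T" for U
  proof -
    have "T \<subseteq> {1..K * (a + b)} \<times> {..<B}"
      using dN unfolding T_def by (intro UN_least Sigma_mono) (auto simp: G_def)
    then show ?thesis using that by (force simp: valid_library_def lib_def)
  qed
  have agree: "lib U (d k) = lib V (d k)"
    if UV: "U \<subseteq> T" "V \<subseteq> T" and X: "X d (lib U) = X d (lib V)" and k: "k \<in> {1..K}" for U V k
    using k
  \<comment> \<open>Ranks are integers and may be negative; subtracting their minimum gives a
    natural number for the induction.\<close>
  proof (induction k rule: measure_induct_rule[where f = "\<lambda>k. nat (rk k - Min (rk ` {1..K}))"])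
    case (less k)
    have IH: "lib U (d l) = lib V (d l)" if "l \<in> {1..K}" "rk l < rk k" for l
    proof -
      have "Min (rk ` {1..K}) \<le> rk l" using that by (intro Min_le) auto
      then have "nat (rk l - Min (rk ` {1..K})) < nat (rk k - Min (rk ` {1..K}))"
        using that by linarith
      then show ?thesis using that by (intro less.IH)
    qed
    have "cache_content (S k) (lib U) = cache_content (S k) (lib V)"
    proof
      fix x
      show "cache_content (S k) (lib U) x = cache_content (S k) (lib V) x"
      \<comment> \<open>A cached bit in \<open>T\<close> belongs to the demand of a user of strictly
        smaller rank and is settled by induction; any other position reads false on both
        sides.\<close>
      proof (cases "x \<in> S k \<and> x \<in> T")
        case True
        then obtain l j where l: "l \<in> {1..K}" "x = (d l, j)" "j \<in> G l"
          by (auto simp: T_def)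
        then have "\<not> rk k \<le> rk l"
          using True less.prems by (auto simp: G_def)
        then show ?thesis using IH[of l] l by (simp add: cache_content_def)
      next
        case False
        then show ?thesis using UV by (auto simp: cache_content_def lib_def)
      qed
    qed
    then show ?case
      using decodes[OF d valid[OF UV(1)] less.prems] decodes[OF d valid[OF UV(2)] less.prems] X
      by simp
  qed
  \<comment> \<open>Distinct subsets of \<open>T\<close> need distinct messages, and only
    \<open>2 ^ L\<close> messages exist; counting gives \<open>card T \<le> L\<close>.\<close>
  have "inj_on (\<lambda>U. X d (lib U)) (Pow T)"
  proof (rule inj_onI)
    fix U V assume UV: "U \<in> Pow T" "V \<in> Pow T" "X d (lib U) = X d (lib V)"
    then have "(d k, j) \<in> U \<longleftrightarrow> (d k, j) \<in> V" if "k \<in> {1..K}" for k j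
      using agree[of U V k] that by (auto simp: lib_def fun_eq_iff)
    then show "U = V" using UV(1,2) by (auto simp: T_def)
  qed
  moreover have "(\<lambda>U. X d (lib U)) ` Pow T \<subseteq> {xs. set xs \<subseteq> UNIV \<and> length xs = L}"
    using len_X[OF d valid] by auto
  ultimately have "card (Pow T) \<le> card {xs :: bool list. set xs \<subseteq> UNIV \<and> length xs = L}"
    by (intro card_inj_on_le finite_lists_length_eq) auto
  also have "\<dots> = 2 ^ L" by (subst card_lists_length_eq) auto
  finally have "card T \<le> L" by (simp add: card_Pow finT)
  have cardT: "card T = (\<Sum>k\<in>{1..K}. card (G k))"
  proof -
    have "({d k} \<times> G k) \<inter> ({d l} \<times> G l) = {}" if "k \<in> {1..K}" "l \<in> {1..K}" "k \<noteq> l" for k l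
      using inj_onD[OF inj _ that(1,2)] that(3) by blast
    then show ?thesis
      unfolding T_def using finG by (subst card_UN_disjoint) (simp_all add: card_cartesian_product)
  qed
  have bound: "max 0 (real B - (\<Sum>l\<in>{l\<in>{1..K}. rk l \<le> rk k}. cached l (d k))) \<le> real (card (G k))" for k
  proof -
    let ?A = "{l\<in>{1..K}. rk l \<le> rk k}"
    let ?U = "\<Union>l\<in>?A. {j. j < B \<and> (d k, j) \<in> S l}"
    have "card {..<B} \<le> card (G k \<union> ?U)"
      by (intro card_mono finite_UnI finG) (auto simp: G_def)
    also have "\<dots> \<le> card (G k) + card ?U" by (rule card_Un_le)
    also have "card ?U \<le> (\<Sum>l\<in>?A. card {j. j < B \<and> (d k, j) \<in> S l})"
      by (intro card_UN_le) auto
    finally have "real B \<le> real (card (G k) + (\<Sum>l\<in>?A. card {j. j < B \<and> (d k, j) \<in> S l}))"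
      by (simp only: of_nat_le_iff card_lessThan)
    then show ?thesis by (simp add: cached_def)
  qed
  have "(\<Sum>k\<in>{1..K}. max 0 (real B - (\<Sum>l\<in>{l\<in>{1..K}. rk l \<le> rk k}. cached l (d k))))
      \<le> (\<Sum>k\<in>{1..K}. real (card (G k)))"
    by (intro sum_mono bound)
  also have "\<dots> = real (\<Sum>k\<in>{1..K}. card (G k))" by simp
  also have "\<dots> \<le> real L" using cardT \<open>card T \<le> L\<close> by (simp only: of_nat_le_iff)
  finally show ?thesis .
qed

text \<open>Two cyclic orders are used. Starting with user \<open>i\<close> and going up, each user demands a
  file shared with its successor; going down to user \<open>i\<close>, each demands a file shared with its
  predecessor. A file shared by users \<open>j - 1\<close> and \<open>j\<close> is then charged once, in one of the two
  orders, for each copy of one of its bits.\<close>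
lemma cyclic_bound:
  assumes i: "i \<in> {1..K}" and t: "t < a"
    and x: "x \<in> Dset K a b (pred_user K i)" "\<And>j. j \<in> {1..K} - {i} \<Longrightarrow> x \<noteq> file_ix (a + b) j t"
    and y: "y \<in> Dset K a b i" "\<And>j. j \<in> {1..K} - {i} \<Longrightarrow> y \<noteq> file_ix (a + b) j t"
  shows "(\<Sum>j\<in>{1..K} - {i}. 2 * real B - copies (file_ix (a + b) j t))
           + max 0 (real B - copies x) + max 0 (real B - copies y) \<le> 2 * real L"
proof -
  let ?m = "a + b" and ?p = "pred_user K i"
  \<comment> \<open>Distance from \<open>i\<close> going upwards around the cycle: \<open>i\<close>
    has rank 0, its predecessor rank \<open>K - 1\<close>. The demands \<open>d1\<close> and
    \<open>d2\<close> use the common files of index \<open>t\<close> in all blocks except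
    \<open>i\<close>; the user coming last in each order is free to ask for \<open>x\<close> or
    \<open>y\<close>.\<close>
  define rk :: "nat \<Rightarrow> int" where
    "rk l = (if i \<le> l then int l - int i else int l + int K - int i)" for l
  define d1 where "d1 k = (if k = ?p then x else file_ix ?m (succ_user K k) t)" for k
  define d2 where "d2 k = (if k = i then y else file_ix ?m k t)" for k
  have tm: "t < ?m" using t by simp
  have mem3: "file_ix ?m (succ_user K k) t \<in> Dset K a b k" if "k \<in> {1..K}" for k
    using that mem_Dset1[OF _ t, of "succ_user K k" b] succ_user_in[OF that]
    by (auto simp: Dset_def Dset3_succ_user)
  have mem1: "file_ix ?m k t \<in> Dset K a b k" if "k \<in> {1..K}" for k
    using that mem_Dset1[OF _ t, of k b] by (auto simp: Dset_def)
  have v1: "valid_demand K a b d1" using mem3 x(1) by (auto simp: valid_demand_def d1_def)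
  have v2: "valid_demand K a b d2" using mem1 y(1) by (auto simp: valid_demand_def d2_def)
  have sne: "succ_user K k \<in> {1..K} - {i}" if "k \<in> {1..K}" "k \<noteq> ?p" for k
    using that succ_user_in[of k K] pred_succ_user[of k K] by auto
  have i1: "inj_on d1 {1..K}"
  proof (rule inj_onI)
    fix k k' assume kk: "k \<in> {1..K}" "k' \<in> {1..K}" "d1 k = d1 k'"
    have "k = k'" if "k \<noteq> ?p" "k' \<noteq> ?p"
    proof -
      have "succ_user K k = succ_user K k'"
        using kk that file_ix_eq_iff[OF succ_user_in succ_user_in tm tm] by (auto simp: d1_def)
      then have "pred_user K (succ_user K k) = pred_user K (succ_user K k')" by (rule arg_cong)
      then show ?thesis by (simp only: pred_succ_user[OF kk(1)] pred_succ_user[OF kk(2)])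
    qed
    moreover have "d1 l \<noteq> x" if "l \<in> {1..K}" "l \<noteq> ?p" for l
      using x(2)[OF sne[OF that]] not_sym that(2) by (simp only: d1_def if_False)
    moreover have "d1 ?p = x" by (simp add: d1_def)
    ultimately show "k = k'" using kk by metis
  qed
  have i2: "inj_on d2 {1..K}"
  proof (rule inj_onI)
    fix k k' assume kk: "k \<in> {1..K}" "k' \<in> {1..K}" "d2 k = d2 k'"
    have "k = k'" if "k \<noteq> i" "k' \<noteq> i"
      using kk that file_ix_eq_iff[OF kk(1,2) tm tm] by (simp add: d2_def)
    moreover have "d2 l \<noteq> y" if "l \<in> {1..K}" "l \<noteq> i" for l
      using y(2)[of l] that by (auto simp: d2_def)
    moreover have "d2 i = y" by (simp add: d2_def)
    ultimately show "k = k'" using kk by metis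
  qed
  define F where "F k = max 0 (real B - (\<Sum>l\<in>{l\<in>{1..K}. rk l \<le> rk k}. cached l (d1 k)))" for k
  define H where "H k = max 0 (real B - (\<Sum>l\<in>{l\<in>{1..K}. rk k \<le> rk l}. cached l (d2 k)))" for k
  have "sum F {1..K} \<le> real L"
    using index_coding_bound[OF v1 i1, of rk] by (simp add: F_def)
  moreover have "sum H {1..K} \<le> real L"
    using index_coding_bound[OF v2 i2, of "\<lambda>l. - rk l"] by (simp add: H_def)
  moreover have "sum F {1..K} = (\<Sum>j\<in>{1..K}. F (pred_user K j))"
    using sum.reindex_bij_betw[OF bij_betw_pred_user, of F K] by simp
  moreover have "\<dots> = F ?p + (\<Sum>j\<in>{1..K} - {i}. F (pred_user K j))"
    using i by (intro sum.remove) auto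
  moreover have "sum H {1..K} = H i + sum H ({1..K} - {i})"
    using i by (intro sum.remove) auto
  moreover have "F ?p = max 0 (real B - copies x)"
  proof -
    have "{l\<in>{1..K}. rk l \<le> rk ?p} = {1..K}"
      using i by (auto simp: rk_def pred_user_def)
    then show ?thesis by (simp add: F_def d1_def copies_def)
  qed
  moreover have "H i = max 0 (real B - copies y)"
  proof -
    have "{l\<in>{1..K}. rk i \<le> rk l} = {1..K}"
      using i by (auto simp: rk_def)
    then show ?thesis by (simp add: H_def d2_def copies_def)
  qed
  moreover have "(\<Sum>j\<in>{1..K} - {i}. 2 * real B - copies (file_ix ?m j t))
      \<le> (\<Sum>j\<in>{1..K} - {i}. F (pred_user K j) + H j)"
  proof (rule sum_mono)
    fix j assume j: "j \<in> {1..K} - {i}"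
    let ?n = "file_ix ?m j t"
    have "pred_user K j \<noteq> ?p" using j i succ_pred_user by (metis DiffE singletonI)
    then have d1: "d1 (pred_user K j) = ?n" using j by (simp add: d1_def succ_pred_user)
    have d2: "d2 j = ?n" using j by (simp add: d2_def)
    \<comment> \<open>As \<open>j\<close> is not \<open>i\<close>, the order does not wrap between
      \<open>j\<close> and its predecessor, so the two rank sets below partition the users.\<close>
    have rkj: "rk (pred_user K j) = rk j - 1" using j i by (auto simp: rk_def pred_user_def)
    have "copies ?n = (\<Sum>l\<in>{l\<in>{1..K}. rk l \<le> rk (pred_user K j)} \<union> {l\<in>{1..K}. rk j \<le> rk l}. cached l ?n)"
      unfolding copies_def by (rule sum.cong) (auto simp: rkj)
    also have "\<dots> = (\<Sum>l\<in>{l\<in>{1..K}. rk l \<le> rk (pred_user K j)}. cached l ?n)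
        + (\<Sum>l\<in>{l\<in>{1..K}. rk j \<le> rk l}. cached l ?n)"
      by (rule sum.union_disjoint) (auto simp: rkj)
    finally show "2 * real B - copies ?n \<le> F (pred_user K j) + H j"
      unfolding F_def H_def d1 d2 by linarith
  qed
  moreover have "\<dots> = (\<Sum>j\<in>{1..K} - {i}. F (pred_user K j)) + sum H ({1..K} - {i})"
    by (rule sum.distrib)
  ultimately show ?thesis by linarith
qed

text \<open>A constant rank discards every bit cached anywhere; what is left of distinct private
  demands must be carried by the message.\<close>

lemma private_bound:
  assumes t: "t < b"
  shows "real K * real B - (\<Sum>k\<in>{1..K}. copies (file_ix (a + b) k (a + t))) \<le> real L"
proof -
  let ?d = "\<lambda>k. file_ix (a + b) k (a + t)"
  have "valid_demand K a b ?d" using mem_Dset2[OF _ t] by (auto simp: valid_demand_def Dset_def)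
  moreover have "inj_on ?d {1..K}"
    by (rule inj_onI) (use t in \<open>auto simp: file_ix_eq_iff\<close>)
  ultimately have "(\<Sum>k\<in>{1..K}. max 0 (real B - copies (?d k))) \<le> real L"
    using index_coding_bound[of ?d "\<lambda>_. 0"] by (simp add: copies_def atLeastAtMost_def atLeast_def atMost_def Int_def)
  moreover have "(\<Sum>k\<in>{1..K}. real B - copies (?d k)) \<le> (\<Sum>k\<in>{1..K}. max 0 (real B - copies (?d k)))"
    by (rule sum_mono) simp
  ultimately show ?thesis by (simp add: sum_subtractf)
qed

section \<open>Averaging the bounds over starting users and over files\<close>

lemma sum_others:
  "(\<Sum>i\<in>{1..K}. \<Sum>j\<in>{1..K} - {i}. f j) = (real K - 1) * (\<Sum>j\<in>{1..K}. f j)" for f :: "nat \<Rightarrow> real"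
proof -
  have "(\<Sum>i\<in>{1..K}. \<Sum>j\<in>{1..K} - {i}. f j) = (\<Sum>i\<in>{1..K}. (\<Sum>j\<in>{1..K}. f j) - f i)"
    by (rule sum.cong) (auto simp: sum_diff1)
  then show ?thesis by (simp add: sum_subtractf algebra_simps)
qed

text \<open>Summing over all starting users makes the bound symmetric: block \<open>j\<close> is
  skipped only for \<open>i = j\<close>, whence the factor \<open>K - 1\<close>. The truncated terms
  are kept so that each use can estimate them either linearly or by 0.\<close>

lemma cyclic_bound_sum:
  assumes t: "t < a"
    and x: "\<And>i. i \<in> {1..K} \<Longrightarrow> x i \<in> Dset K a b (pred_user K i)"
      "\<And>i j. i \<in> {1..K} \<Longrightarrow> j \<in> {1..K} - {i} \<Longrightarrow> x i \<noteq> file_ix (a + b) j t"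
    and y: "\<And>i. i \<in> {1..K} \<Longrightarrow> y i \<in> Dset K a b i"
      "\<And>i j. i \<in> {1..K} \<Longrightarrow> j \<in> {1..K} - {i} \<Longrightarrow> y i \<noteq> file_ix (a + b) j t"
  shows "2 * real K * (real K - 1) * real B
      - (real K - 1) * (\<Sum>j\<in>{1..K}. copies (file_ix (a + b) j t))
      + (\<Sum>i\<in>{1..K}. max 0 (real B - copies (x i)) + max 0 (real B - copies (y i)))
      \<le> 2 * real K * real L"
proof -
  have "(\<Sum>i\<in>{1..K}. (\<Sum>j\<in>{1..K} - {i}. 2 * real B - copies (file_ix (a + b) j t))
       + (max 0 (real B - copies (x i)) + max 0 (real B - copies (y i)))) \<le> (\<Sum>i\<in>{1..K}. 2 * real L)"
    using cyclic_bound[OF _ t x y] by (intro sum_mono) (simp add: add.assoc)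
  then show ?thesis
    unfolding sum.distrib sum_others by (simp add: sum_subtractf algebra_simps)
qed

text \<open>The last user of each order demands the common file of the omitted block
  \<open>i\<close>. Estimating the truncated terms linearly gives the first bound, by 0 the second,
  which is stronger once \<open>c\<close> exceeds \<open>K * B\<close>.\<close>

lemma common_bounds:
  assumes t: "t < a"
  defines "c \<equiv> \<Sum>j\<in>{1..K}. copies (file_ix (a + b) j t)"
  shows "2 * real K * real K * real B - (real K + 1) * c \<le> 2 * real K * real L"
    and "2 * real K * (real K - 1) * real B - (real K - 1) * c \<le> 2 * real K * real L"
proof -
  let ?x = "\<lambda>i. file_ix (a + b) i t"
  have 1: "2 * real K * (real K - 1) * real B - (real K - 1) * c
      + (\<Sum>i\<in>{1..K}. max 0 (real B - copies (?x i)) + max 0 (real B - copies (?x i)))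
      \<le> 2 * real K * real L"
    unfolding c_def
  proof (rule cyclic_bound_sum[OF t])
    fix i assume i: "i \<in> {1..K}"
    show "?x i \<in> Dset K a b i" using i mem_Dset1[OF _ t, of i b] by (auto simp: Dset_def)
    show "?x i \<in> Dset K a b (pred_user K i)"
      using i mem_Dset1[OF _ t, of i b] Dset3_pred_user[OF i, of a b] by (auto simp: Dset_def)
    fix j assume "j \<in> {1..K} - {i}"
    then show "?x i \<noteq> ?x j" "?x i \<noteq> ?x j" using i t file_ix_eq_iff[of i K j t "a + b" t] by auto
  qed
  have "0 \<le> (\<Sum>i\<in>{1..K}. max 0 (real B - copies (?x i)) + max 0 (real B - copies (?x i)))"
    by (intro sum_nonneg) simp
  with 1 show "2 * real K * (real K - 1) * real B - (real K - 1) * c \<le> 2 * real K * real L"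
    by linarith
  have "(\<Sum>i\<in>{1..K}. 2 * (real B - copies (?x i)))
      \<le> (\<Sum>i\<in>{1..K}. max 0 (real B - copies (?x i)) + max 0 (real B - copies (?x i)))"
    by (intro sum_mono) (simp only: mult_2 add_mono max.cobounded2)
  also have "(\<Sum>i\<in>{1..K}. 2 * (real B - copies (?x i))) = 2 * (real K * real B - c)"
    by (simp add: sum_distrib_left[symmetric] sum_subtractf c_def)
  finally show "2 * real K * real K * real B - (real K + 1) * c \<le> 2 * real K * real L"
    using 1 by (simp add: algebra_simps)
qed

text \<open>The last user of each order, \<open>pred_user K i\<close> or \<open>i\<close>, asks for
  its private file, which trades copies of common files against copies of private ones.\<close>

lemma mixed_bound:
  assumes t: "t < a" and s: "s < b"
  defines "c \<equiv> \<Sum>j\<in>{1..K}. copies (file_ix (a + b) j t)"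
    and "p \<equiv> \<Sum>j\<in>{1..K}. copies (file_ix (a + b) j (a + s))"
  shows "2 * real K * real K * real B - (real K - 1) * c - 2 * p \<le> 2 * real K * real L"
proof -
  let ?y = "\<lambda>i. file_ix (a + b) i (a + s)"
  let ?x = "\<lambda>i. ?y (pred_user K i)"
  have 1: "2 * real K * (real K - 1) * real B - (real K - 1) * c
      + (\<Sum>i\<in>{1..K}. max 0 (real B - copies (?x i)) + max 0 (real B - copies (?y i)))
      \<le> 2 * real K * real L"
    unfolding c_def
  proof (rule cyclic_bound_sum[OF t])
    fix i assume i: "i \<in> {1..K}"
    note pi = pred_user_in[OF i]
    show "?y i \<in> Dset K a b i" using i mem_Dset2[OF _ s, of i a] by (auto simp: Dset_def)
    show "?x i \<in> Dset K a b (pred_user K i)"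
      using pi mem_Dset2[OF _ s, of "pred_user K i" a] by (auto simp: Dset_def)
    fix j assume "j \<in> {1..K} - {i}"
    then show "?x i \<noteq> file_ix (a + b) j t" "?y i \<noteq> file_ix (a + b) j t"
      using i pi t s file_ix_eq_iff[of _ K j "a + s" "a + b" t] by auto
  qed
  have "(\<Sum>i\<in>{1..K}. (real B - copies (?x i)) + (real B - copies (?y i)))
      \<le> (\<Sum>i\<in>{1..K}. max 0 (real B - copies (?x i)) + max 0 (real B - copies (?y i)))"
    by (intro sum_mono) simp
  also have "(\<Sum>i\<in>{1..K}. (real B - copies (?x i)) + (real B - copies (?y i))) = 2 * (real K * real B - p)"
    using sum.reindex_bij_betw[OF bij_betw_pred_user, of "\<lambda>i. copies (?y i)" K]
    unfolding sum.distrib sum_subtractf p_def by simp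
  finally show ?thesis using 1 by (simp add: algebra_simps)
qed

lemma sum_cached: "l \<in> {1..K} \<Longrightarrow> (\<Sum>n\<in>{1..K * (a + b)}. cached l n) = real (card (S l))"
proof -
  assume l: "l \<in> {1..K}"
  have "S l = Sigma {1..K * (a + b)} (\<lambda>n. {j. j < B \<and> (n, j) \<in> S l})"
    using S_sub[OF l] by auto
  then have "card (S l) = card (Sigma {1..K * (a + b)} (\<lambda>n. {j. j < B \<and> (n, j) \<in> S l}))"
    by simp
  also have "\<dots> = (\<Sum>n\<in>{1..K * (a + b)}. card {j. j < B \<and> (n, j) \<in> S l})"
    by (rule card_SigmaI) auto
  finally have "card (S l) = (\<Sum>n\<in>{1..K * (a + b)}. card {j. j < B \<and> (n, j) \<in> S l})" .
  then show ?thesis by (simp add: cached_def)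
qed

lemma total_memory:
  "(\<Sum>k\<in>{1..K}. \<Sum>t<a + b. copies (file_ix (a + b) k t)) \<le> real K * M * real B"
proof -
  let ?f = "\<lambda>(k, t). file_ix (a + b) k t" and ?D = "{1..K} \<times> {..<a + b}"
  have sub: "?f ` ?D \<subseteq> {1..K * (a + b)}"
  proof clarify
    fix k t assume k: "k \<in> {1..K}" and t: "t < a + b"
    obtain k' where k': "k = Suc k'" "Suc k' \<le> K" using k by (cases k) auto
    have "Suc k' * (a + b) \<le> K * (a + b)" using k' by (intro mult_le_mono1) simp
    then show "file_ix (a + b) k t \<in> {1..K * (a + b)}"
      using t k' by (simp add: file_ix_def)
  qed
  have "(\<Sum>k\<in>{1..K}. \<Sum>t<a + b. copies (file_ix (a + b) k t)) = sum copies (?f ` ?D)"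
    unfolding sum.reindex[OF inj_on_file_ix] by (simp add: sum.cartesian_product comp_def split_beta')
  also have "\<dots> \<le> sum copies {1..K * (a + b)}"
    by (intro sum_mono2 sub) (auto simp: copies_def cached_def intro!: sum_nonneg)
  also have "\<dots> = (\<Sum>l\<in>{1..K}. \<Sum>n\<in>{1..K * (a + b)}. cached l n)"
    unfolding copies_def by (rule sum.swap)
  also have "\<dots> \<le> (\<Sum>l\<in>{1..K}. M * real B)"
    using S_card sum_cached by (intro sum_mono) simp
  finally show ?thesis by (simp add: mult.assoc)
qed

lemma exists_below_average:
  fixes g :: "nat \<Rightarrow> real"
  assumes "n \<ge> 1"
  obtains t where "t < n" "real n * g t \<le> (\<Sum>s<n. g s)"
proof (rule ccontr)
  assume "\<not> thesis"
  then have "\<And>t. t < n \<Longrightarrow> (\<Sum>s<n. g s) < real n * g t" using that by force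
  then have "(\<Sum>t<n. (\<Sum>s<n. g s)) < (\<Sum>t<n. real n * g t)"
    using assms by (intro sum_strict_mono) (auto simp: lessThan_empty_iff)
  then show False by (simp add: sum_distrib_left)
qed

lemma load_bounds:
  obtains c p :: real where
    "real a * c + real b * p \<le> M"
    "2 * real K - (real K - 1) * c - 2 * p \<le> 2 * (real L / real B)"
    "2 * (real K - 1) - (real K - 1) * c \<le> 2 * (real L / real B)"
    "real K - real K * p \<le> real L / real B"
    "2 * real K - (real K + 1) * c \<le> 2 * (real L / real B)"
proof -
  define g where "g t = (\<Sum>j\<in>{1..K}. copies (file_ix (a + b) j t))" for t
  \<comment> \<open>Taking one common and one private index below average lets bounds for single
    indices be combined with the memory constraint for all files.\<close>
  obtain t where t: "t < a" "real a * g t \<le> (\<Sum>s<a. g s)"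
    using exists_below_average[OF a1] by metis
  obtain u where u: "u < b" "real b * g (a + u) \<le> (\<Sum>s<b. g (a + s))"
    using exists_below_average[OF b1, of "\<lambda>s. g (a + s)"] by metis
  have "(\<Sum>s<a. g s) + (\<Sum>s<b. g (a + s)) = (\<Sum>s<a + b. g s)"
    using sum.atLeastLessThan_concat[of 0 a "a + b" g] sum.shift_bounds_nat_ivl[of g 0 a b]
    by (simp add: atLeast0LessThan add.commute)
  also have "\<dots> = (\<Sum>k\<in>{1..K}. \<Sum>t<a + b. copies (file_ix (a + b) k t))"
    unfolding g_def by (rule sum.swap)
  finally have mem: "real a * g t + real b * g (a + u) \<le> real K * M * real B"
    using total_memory t u by linarith
  \<comment> \<open>Mean number of copies of a bit: each sum runs over \<open>K\<close> files of
    \<open>B\<close> bits.\<close>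
  define c p R where "c = g t / (real K * real B)" and "p = g (a + u) / (real K * real B)"
    and "R = real L / real B"
  have KB: "real K * real B > 0" using K2 B1 by auto
  have g: "g t = real K * real B * c" "g (a + u) = real K * real B * p" and L: "real L = real B * R"
    using K2 B1 by (simp_all add: c_def p_def R_def)
  have cancel: "v \<le> w" if "real K * real B * v \<le> real K * real B * w" for v w
    using that KB by (simp only: mult_le_cancel_left_pos)
  show thesis
  proof (rule that[of c p, folded R_def]; rule cancel)
    show "real K * real B * (real a * c + real b * p) \<le> real K * real B * M"
      using mem unfolding g by (simp add: algebra_simps)
    show "real K * real B * (2 * real K - (real K - 1) * c - 2 * p) \<le> real K * real B * (2 * R)"
      using mixed_bound[OF t(1) u(1)] unfolding g_def[symmetric] g L by (simp add: algebra_simps)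
    show "real K * real B * (2 * (real K - 1) - (real K - 1) * c) \<le> real K * real B * (2 * R)"
      using common_bounds(2)[OF t(1)] unfolding g_def[symmetric] g L by (simp add: algebra_simps)
    show "real K * real B * (real K - real K * p) \<le> real K * real B * R"
      using mult_left_mono[OF private_bound[OF u(1)], of "real K"]
      unfolding g_def[symmetric] g L by (simp add: algebra_simps)
    show "real K * real B * (2 * real K - (real K + 1) * c) \<le> real K * real B * (2 * R)"
      using common_bounds(1)[OF t(1)] unfolding g_def[symmetric] g L by (simp add: algebra_simps)
  qed
qed

end

section \<open>Convex combinations of the load bounds in the two regimes\<close>

lemma achievable_load_bounds:
  assumes "K \<ge> 2" "a \<ge> 1" "b \<ge> 1" "achievable_u K a b M R"
  obtains c p :: real where
    "real a * c + real b * p \<le> M"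
    "2 * real K - (real K - 1) * c - 2 * p \<le> 2 * R"
    "2 * (real K - 1) - (real K - 1) * c \<le> 2 * R"
    "real K - real K * p \<le> R"
    "2 * real K - (real K + 1) * c \<le> 2 * R"
proof -
  obtain B L S X dec where R: "R = real L / real B" and sch: "uncoded_scheme K a b B L M S X dec"
  proof -
    from assms(4) obtain B L S dec
      and X :: "(nat \<Rightarrow> nat) \<Rightarrow> (nat \<Rightarrow> nat \<Rightarrow> bool) \<Rightarrow> bool list"
      where B: "B \<ge> 1" and R: "R = real L / real B"
      and S: "\<forall>k\<in>{1..K}. S k \<subseteq> {1..K * (a + b)} \<times> {..<B} \<and> real (card (S k)) \<le> M * real B"
      and X: "\<forall>d W. valid_demand K a b d \<longrightarrow> valid_library (K * (a + b)) B W \<longrightarrow>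
            length (X d W) = L \<and> (\<forall>k\<in>{1..K}. dec k d (cache_content (S k) W) (X d W) = W (d k))"
      unfolding achievable_u_def by (elim exE conjE) (rule that)
    have "uncoded_scheme K a b B L M S X dec"
      by unfold_locales (use assms(1-3) B S X in \<open>simp_all\<close>)
    with R show thesis by (rule that)
  qed
  show thesis using uncoded_scheme.load_bounds[OF sch] that unfolding R by blast
qed

lemma converse_common_regime:
  assumes "K \<ge> 2" "a \<ge> 1" "b \<ge> 1" "achievable_u K a b M R"
    and reg: "real b * (real K - 1) \<le> 2 * real a"
  shows "real K - (real K + 1) / (2 * (real a + real b)) * M \<le> R"
    and "(real K - 1) * (2 * real a + real b) / (2 * real a) - (real K - 1) / (2 * real a) * M \<le> R"
proof -
  obtain c p where cp: "real a * c + real b * p \<le> M"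
    and E1: "2 * real K - (real K - 1) * c - 2 * p \<le> 2 * R"
    and E2: "2 * (real K - 1) - (real K - 1) * c \<le> 2 * R"
    and E4: "2 * real K - (real K + 1) * c \<le> 2 * R"
    using achievable_load_bounds[OF assms(1-4)] by metis
  define k x y where "k = real K - 1" and "x = real a" and "y = real b"
  have pos: "k \<ge> 1" "x > 0" "y > 0" using assms by (auto simp: k_def x_def y_def)
  have K: "real K = k + 1" by (simp add: k_def)
  note E = cp E1 E2 E4 reg
  note E' = E[unfolded K, folded x_def y_def]
  \<comment> \<open>The weights \<open>2 * x - y * k\<close> and \<open>2 * y + y * k\<close> sum to
    \<open>2 * (x + y)\<close> and give \<open>c\<close> and \<open>p\<close> the total coefficients
    \<open>2 * x * (k + 2)\<close> and \<open>2 * y * (k + 2)\<close>, so the memory constraint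
    eliminates both. The regime makes the first weight nonnegative.\<close>
  have "(2 * x - y * k) * (2 * (k + 1) - (k + 2) * c) \<le> (2 * x - y * k) * (2 * R)"
    using E' by (intro mult_left_mono) (auto simp: algebra_simps)
  moreover have "(2 * y + y * k) * (2 * (k + 1) - k * c - 2 * p) \<le> (2 * y + y * k) * (2 * R)"
    using E' pos by (intro mult_left_mono) auto
  moreover have "(k + 2) * (x * c + y * p) \<le> (k + 2) * M"
    using E' pos by (intro mult_left_mono) auto
  ultimately have "2 * (x + y) * (k + 1) - (k + 2) * M \<le> 2 * (x + y) * R"
    by (simp add: algebra_simps)
  then have "(2 * (x + y) * (k + 1) - (k + 2) * M) / (2 * (x + y)) \<le> R"
    using pos by (simp add: pos_divide_le_eq mult.commute)
  moreover have "(2 * (x + y) * (k + 1) - (k + 2) * M) / (2 * (x + y)) = k + 1 - (k + 2) / (2 * (x + y)) * M"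
    using pos by (simp add: diff_divide_distrib)
  ultimately show "real K - (real K + 1) / (2 * (real a + real b)) * M \<le> R"
    by (simp add: K x_def y_def add.commute)
  have "k * (2 * x + y - M) \<le> 2 * x * R"
  \<comment> \<open>For \<open>p\<close> at most 1 the mixed bound works, with nonnegative leftover
    \<open>(2 * x - y * k) * (1 - p)\<close>; for larger \<open>p\<close> the bound free of
    \<open>p\<close> works, with leftover \<open>k * y * (p - 1)\<close>.\<close>
  proof (cases "p \<le> 1")
    case True
    have "x * (2 * (k + 1) - k * c - 2 * p) \<le> x * (2 * R)"
      using E' pos by (intro mult_left_mono) auto
    moreover have "(2 * x - y * k) * (1 - p) \<ge> 0"
      using E' True by (intro mult_nonneg_nonneg) (auto simp: algebra_simps)
    moreover have "k * (x * c + y * p) \<le> k * M"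
      using E' pos by (intro mult_left_mono) auto
    ultimately show ?thesis by (simp add: algebra_simps)
  next
    case False
    have "x * (2 * k - k * c) \<le> x * (2 * R)"
      using E' pos by (intro mult_left_mono) auto
    moreover have "k * y * (p - 1) \<ge> 0"
      using pos False by (intro mult_nonneg_nonneg) auto
    moreover have "k * (x * c + y * p) \<le> k * M"
      using E' pos by (intro mult_left_mono) auto
    ultimately show ?thesis by (simp add: algebra_simps)
  qed
  then have "k * (2 * x + y - M) / (2 * x) \<le> R"
    using pos by (simp add: pos_divide_le_eq mult.commute)
  moreover have "k * (2 * x + y - M) / (2 * x) = k * (2 * x + y) / (2 * x) - k / (2 * x) * M"
    by (simp add: diff_divide_distrib right_diff_distrib)
  ultimately show "(real K - 1) * (2 * real a + real b) / (2 * real a) - (real K - 1) / (2 * real a) * M \<le> R"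
    by (simp add: k_def x_def y_def)
qed

lemma converse_private_regime:
  assumes "K \<ge> 2" "a \<ge> 1" "b \<ge> 1" "achievable_u K a b M R"
    and reg: "2 * real a \<le> real b * (real K - 1)"
  shows "real K - real K / (2 * real a + real b) * M \<le> R"
proof -
  obtain c p where cp: "real a * c + real b * p \<le> M"
    and E1: "2 * real K - (real K - 1) * c - 2 * p \<le> 2 * R"
    and E3: "real K - real K * p \<le> R"
    using achievable_load_bounds[OF assms(1-4)] by metis
  define k x y where "k = real K - 1" and "x = real a" and "y = real b"
  have pos: "k \<ge> 1" "x > 0" "y > 0" using assms by (auto simp: k_def x_def y_def)
  have K: "real K = k + 1" by (simp add: k_def)
  note E = cp E1 E3 reg
  note E' = E[unfolded K, folded x_def y_def]
  \<comment> \<open>The weights \<open>x * (k + 1)\<close> and \<open>y * k - 2 * x\<close> collect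
    \<open>c\<close> and \<open>p\<close> into \<open>k * (k + 1) * (x * c + y * p)\<close>;
    afterwards a factor \<open>k\<close> cancels.\<close>
  have "x * (k + 1) * (2 * (k + 1) - k * c - 2 * p) \<le> x * (k + 1) * (2 * R)"
    using E' pos by (intro mult_left_mono) auto
  moreover have "(y * k - 2 * x) * (k + 1 - (k + 1) * p) \<le> (y * k - 2 * x) * R"
    using E' by (intro mult_left_mono) auto
  moreover have "k * (k + 1) * (x * c + y * p) \<le> k * (k + 1) * M"
    using E' pos by (intro mult_left_mono) auto
  ultimately have "k * ((2 * x + y) * (k + 1) - (k + 1) * M) \<le> k * ((2 * x + y) * R)"
    by (simp add: algebra_simps)
  then have "(2 * x + y) * (k + 1) - (k + 1) * M \<le> (2 * x + y) * R"
    using pos by simp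
  then have "((2 * x + y) * (k + 1) - (k + 1) * M) / (2 * x + y) \<le> R"
    using pos by (simp add: pos_divide_le_eq mult.commute)
  moreover have "((2 * x + y) * (k + 1) - (k + 1) * M) / (2 * x + y) = k + 1 - (k + 1) / (2 * x + y) * M"
    using pos by (simp add: diff_divide_distrib)
  ultimately show ?thesis by (simp add: K x_def y_def)
qed

section \<open>Achievability\<close>

text \<open>If the sent bits and the cache determine the requested file, a decoder may pick any
  library consistent with them and read the file off. The labelled bits are sent in an order
  depending on \<open>d\<close> only.\<close>

lemma achievable_uI:
  fixes f :: "(nat \<Rightarrow> nat) \<Rightarrow> (nat \<Rightarrow> nat \<Rightarrow> bool) \<Rightarrow> 'i \<Rightarrow> bool"
  assumes "B \<ge> 1"
    and "\<And>k. k \<in> {1..K} \<Longrightarrow> S k \<subseteq> {1..K * (a + b)} \<times> {..<B}"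
    and "\<And>k. k \<in> {1..K} \<Longrightarrow> real (card (S k)) \<le> M * real B"
    and I: "\<And>d. valid_demand K a b d \<Longrightarrow> finite (I d) \<and> card (I d) = L"
    and det: "\<And>d k W W'. valid_demand K a b d \<Longrightarrow> k \<in> {1..K} \<Longrightarrow>
        valid_library (K * (a + b)) B W \<Longrightarrow> valid_library (K * (a + b)) B W' \<Longrightarrow>
        (\<And>x. x \<in> I d \<Longrightarrow> f d W x = f d W' x) \<Longrightarrow>
        cache_content (S k) W = cache_content (S k) W' \<Longrightarrow> W (d k) = W' (d k)"
  shows "achievable_u K a b M (real L / real B)"
proof -
  define xs where "xs d = (SOME xs. set xs = I d \<and> distinct xs)" for d
  have xs: "set (xs d) = I d \<and> distinct (xs d)" if "valid_demand K a b d" for d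
    unfolding xs_def by (rule someI_ex) (use I[OF that] finite_distinct_list in blast)
  define X where "X d W = map (f d W) (xs d)" for d W
  define dec where "dec k d z x = (SOME W. valid_library (K * (a + b)) B W \<and>
    cache_content (S k) W = z \<and> X d W = x) (d k)" for k d z x
  have "length (X d W) = L" if "valid_demand K a b d" for d W
    using xs[OF that] I[OF that] by (metis X_def distinct_card length_map)
  moreover have "dec k d (cache_content (S k) W) (X d W) = W (d k)"
    if d: "valid_demand K a b d" and k: "k \<in> {1..K}" and W: "valid_library (K * (a + b)) B W" for k d W
  proof -
    let ?P = "\<lambda>W'. valid_library (K * (a + b)) B W' \<and>
      cache_content (S k) W' = cache_content (S k) W \<and> X d W' = X d W"
    have "?P (SOME W'. ?P W')" by (rule someI[of ?P W]) (simp add: W)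
    moreover have "W' (d k) = W (d k)" if "?P W'" for W'
      using that W xs[OF d] by (intro det[OF d k]) (auto simp: X_def)
    ultimately show ?thesis unfolding dec_def by blast
  qed
  ultimately show ?thesis
    unfolding achievable_u_def using assms(1-3)
    by (intro exI[of _ B] exI[of _ L] exI[of _ S] exI[of _ X] exI[of _ dec]) auto
qed

section \<open>Split placement and coded delivery\<close>

lemma exists_permuted_subset:
  assumes "finite A" "A \<noteq> {}" "g ` A \<subseteq> A"
  obtains C where "C \<subseteq> A" "C \<noteq> {}" "g ` C = C"
proof -
  have "\<exists>C. C \<subseteq> A \<and> C \<noteq> {} \<and> g ` C = C"
    using assms
  proof (induction A rule: finite_psubset_induct)
    case (psubset A)
    show ?case
    \<comment> \<open>Iterated images of \<open>A\<close> shrink until one is mapped onto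
      itself.\<close>
    proof (cases "g ` A = A")
      case True
      then show ?thesis using psubset by blast
    next
      case False
      then have "g ` A \<subset> A" using psubset by blast
      moreover have "g ` A \<noteq> {}" "g ` g ` A \<subseteq> g ` A" using psubset.prems by auto
      ultimately obtain C where "C \<subseteq> g ` A" "C \<noteq> {}" "g ` C = C"
        using psubset.IH[of "g ` A"] by metis
      then show ?thesis using psubset.prems(2) by (meson order_trans)
    qed
  qed
  then show thesis using that by blast
qed

text \<open>The first \<open>p\<close> bits of each file are cached by all users interested in it, the next
  \<open>2 * q\<close> bits are split between the two users sharing the file, and the last \<open>r\<close> bits are not
  cached.\<close>
definition split_placement :: "nat \<Rightarrow> nat \<Rightarrow> nat \<Rightarrow> nat \<Rightarrow> nat \<Rightarrow> nat \<Rightarrow> (nat \<times> nat) set" where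
  "split_placement K a b p q k =
     Dset1 a b k \<times> {..<p + q} \<union> Dset2 a b k \<times> {..<p + 2 * q} \<union>
     Dset3 K a b k \<times> ({..<p} \<union> {p + q..<p + 2 * q})"

text \<open>The half of the demanded file that user \<open>k\<close> lacks starts at bit \<open>half_offset\<close> and is cached
  by \<open>half_holder\<close>. A private file is stored in full, so any offset does and \<open>k\<close> itself is the
  holder.\<close>
definition half_offset :: "nat \<Rightarrow> nat \<Rightarrow> nat \<Rightarrow> nat \<Rightarrow> (nat \<Rightarrow> nat) \<Rightarrow> nat \<Rightarrow> nat" where
  "half_offset a b p q d k = (if d k \<in> Dset1 a b k then p + q else p)"

definition half_holder :: "nat \<Rightarrow> nat \<Rightarrow> nat \<Rightarrow> (nat \<Rightarrow> nat) \<Rightarrow> nat \<Rightarrow> nat" where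
  "half_holder K a b d k =
     (if d k \<in> Dset1 a b k then pred_user K k
      else if d k \<in> Dset3 K a b k then succ_user K k else k)"

lemma half_holder_in: "k \<in> {1..K} \<Longrightarrow> half_holder K a b d k \<in> {1..K}"
  using pred_user_in succ_user_in by (simp add: half_holder_def)

lemma half_holder_caches:
  assumes "valid_demand K a b d" "k \<in> {1..K}" "j < q"
  shows "(d k, half_offset a b p q d k + j) \<in> split_placement K a b p q (half_holder K a b d k)"
proof -
  have "d k \<in> Dset1 a b k \<union> Dset2 a b k \<union> Dset3 K a b k"
    using assms by (auto simp: valid_demand_def Dset_def)
  then show ?thesis using assms
    by (auto simp: half_holder_def half_offset_def split_placement_def Dset3_pred_user Dset3_succ_user)
qed

lemma cached_or_missing_half:
  assumes "valid_demand K a b d" "k \<in> {1..K}" "j < p + 2 * q"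
  obtains "(d k, j) \<in> split_placement K a b p q k"
  | i where "i < q" "j = half_offset a b p q d k + i"
proof -
  have "d k \<in> Dset1 a b k \<union> Dset2 a b k \<union> Dset3 K a b k"
    using assms by (auto simp: valid_demand_def Dset_def)
  then show thesis
  proof (cases "(d k, j) \<in> split_placement K a b p q k")
    case False
    let ?o = "half_offset a b p q d k"
    have "?o \<le> j \<and> j - ?o < q"
      using False assms \<open>d k \<in> _\<close> by (auto simp: split_placement_def half_offset_def)
    then show ?thesis by (intro that(2)[of "j - ?o"]) auto
  qed (rule that(1))
qed

lemma split_placement_subset:
  assumes "k \<in> {1..K}"
  shows "split_placement K a b p q k \<subseteq> {1..K * (a + b)} \<times> {..<p + 2 * q + r}"
proof -
  have "split_placement K a b p q k \<subseteq> Dset K a b k \<times> {..<p + 2 * q + r}"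
    by (auto simp: split_placement_def Dset_def)
  then show ?thesis using Dset_subset[OF assms] by blast
qed

lemma card_split_placement:
  assumes "k \<in> {1..K}"
  shows "card (split_placement K a b p q k) \<le> (2 * a + b) * p + 2 * (a + b) * q"
proof -
  have "card (split_placement K a b p q k) \<le>
      card (Dset1 a b k \<times> {..<p + q}) + card (Dset2 a b k \<times> {..<p + 2 * q})
      + card (Dset3 K a b k \<times> ({..<p} \<union> {p + q..<p + 2 * q}))"
    unfolding split_placement_def by (intro order_trans[OF card_Un_le] add_mono card_Un_le order_refl)
  also have "\<dots> = a * (p + q) + b * (p + 2 * q) + a * (p + q)"
  proof -
    have "card ({..<p} \<union> {p + q..<p + 2 * q}) = p + q" by (subst card_Un_disjoint) auto
    then show ?thesis
      using assms by (simp add: card_cartesian_product card_Dset1 card_Dset2 card_Dset3)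
  qed
  finally show ?thesis by (simp add: algebra_simps)
qed

text \<open>Each demand costs \<open>r\<close> uncoded bits and \<open>q\<close> bits for its
  missing half, except that coding over a set \<open>C d\<close> stable under
  \<open>half_holder\<close> saves one half.\<close>

lemma achievable_split:
  assumes "K \<ge> 2" "p + 2 * q + r \<ge> 1"
    and mem: "(2 * real a + real b) * real p + 2 * (real a + real b) * real q \<le> M * real (p + 2 * q + r)"
  shows "achievable_u K a b M (((real K - 1) * real q + real K * real r) / real (p + 2 * q + r))"
proof -
  let ?B = "p + 2 * q + r" and ?S = "split_placement K a b p q"
  define A where "A d W k j = W (d k) (half_offset a b p q d k + j)"
    for d k j and W :: "nat \<Rightarrow> nat \<Rightarrow> bool"
  have "\<exists>C. C \<subseteq> {1..K} \<and> C \<noteq> {} \<and> half_holder K a b d ` C = C" for d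
  proof -
    have "{1..K} \<noteq> {}" using assms(1) by simp
    moreover have "half_holder K a b d ` {1..K} \<subseteq> {1..K}" using half_holder_in by blast
    ultimately show ?thesis
      using exists_permuted_subset[of "{1..K}" "half_holder K a b d"] by (metis finite_atLeastAtMost)
  qed
  then obtain C where C: "C d \<subseteq> {1..K}" "C d \<noteq> {}" "half_holder K a b d ` C d = C d" for d
    by metis
  \<comment> \<open>\<open>C d\<close> may be a union of several cycles; a single pivot
    \<open>c d\<close> serves all of it. Its difference with itself carries no information and is
    not sent.\<close>
  define c where "c d = (SOME k. k \<in> C d)" for d
  have c: "c d \<in> C d" for d unfolding c_def using C(2) by (rule some_in_eq[THEN iffD2])
  define I where "I d = ({1..K} - {c d}) \<times> {..<q} \<union> {1..K} \<times> {q..<q + r}" for d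
  \<comment> \<open>Inequality of booleans is exclusive or. For \<open>j\<close> from
    \<open>q\<close> on, the position \<open>p + q + j\<close> starts at \<open>p + 2 * q\<close>,
    the first uncached bit.\<close>
  define f where "f d W = (\<lambda>(k, j). if j < q then
      (if k \<in> C d then A d W k j \<noteq> A d W (c d) j else A d W k j)
      else W (d k) (p + q + j))" for d and W :: "nat \<Rightarrow> nat \<Rightarrow> bool"
  have "achievable_u K a b M (real ((K - 1) * q + K * r) / real ?B)"
  proof (rule achievable_uI[where S = ?S and I = I and f = f])
    show "?B \<ge> 1" by fact
    fix k assume k: "k \<in> {1..K}"
    show "?S k \<subseteq> {1..K * (a + b)} \<times> {..<?B}" by (rule split_placement_subset[OF k])
    have "real (card (?S k)) \<le> real ((2 * a + b) * p + 2 * (a + b) * q)"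
      using card_split_placement[OF k] by (simp only: of_nat_le_iff)
    then show "real (card (?S k)) \<le> M * real ?B" using mem by simp
  next
    fix d
    have "c d \<in> {1..K}" using C c by blast
    then show "finite (I d) \<and> card (I d) = (K - 1) * q + K * r"
      unfolding I_def by (subst card_Un_disjoint) (auto simp: card_cartesian_product)
  next
    fix d k W W'
    assume d: "valid_demand K a b d" and k: "k \<in> {1..K}"
      and W: "valid_library (K * (a + b)) ?B W" "valid_library (K * (a + b)) ?B W'"
      and X: "\<And>x. x \<in> I d \<Longrightarrow> f d W x = f d W' x"
      and Z: "cache_content (?S k) W = cache_content (?S k) W'"
    have known: "W n j = W' n j" if "(n, j) \<in> ?S k" for n j
      using that fun_cong[OF Z, of "(n, j)"] by (simp add: cache_content_def)
    have half: "A d W k j = A d W' k j" if j: "j < q" for j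
    proof (cases "k \<in> C d")
      case False
      then have "(k, j) \<in> I d" using c k j by (auto simp: I_def)
      then show ?thesis using X[of "(k, j)"] False j by (simp add: f_def)
    next
      case True
      have diff: "(A d W l j \<noteq> A d W (c d) j) = (A d W' l j \<noteq> A d W' (c d) j)" if "l \<in> C d" for l
      proof (cases "l = c d")
        case False
        then have "(l, j) \<in> I d" using subsetD[OF C(1) that] j by (simp add: I_def)
        then show ?thesis using X[of "(l, j)"] that j by (simp add: f_def)
      qed simp
      \<comment> \<open>User \<open>k\<close> caches the half missing at some \<open>l\<close> in
        \<open>C d\<close>. The difference for \<open>l\<close> reveals the half of the pivot, and
        the difference for \<open>k\<close> then reveals its own.\<close>
      obtain l where l: "l \<in> C d" "half_holder K a b d l = k" using C(3) True by (metis imageE)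
      have "A d W l j = A d W' l j"
        unfolding A_def using half_holder_caches[OF d subsetD[OF C(1) l(1)] j, of p] l(2) by (intro known) simp
      then show ?thesis using diff[OF l(1)] diff[OF True] by blast
    qed
    show "W (d k) = W' (d k)"
    proof
      fix j
      consider "j < p + 2 * q" | "p + 2 * q \<le> j" "j < ?B" | "?B \<le> j" by linarith
      then show "W (d k) j = W' (d k) j"
      proof cases
        case 1
        then show ?thesis
          by (rule cached_or_missing_half[OF d k]) (use known half in \<open>auto simp: A_def\<close>)
      next
        case 2
        then have "(k, j - (p + q)) \<in> I d" using k by (auto simp: I_def)
        then show ?thesis using X[of "(k, j - (p + q))"] 2 by (simp add: f_def split: if_splits)
      next
        case 3
        then show ?thesis using W by (simp add: valid_library_def)
      qed
    qed
  qed
  then show ?thesis using assms(1) by (simp add: of_nat_diff)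
qed

section \<open>Passing to the infimum and matching the two sides\<close>

lemma Rstar_u_eqI:
  assumes lower: "\<And>R. achievable_u K a b M R \<Longrightarrow> T \<le> R"
    and upper: "\<And>n. n \<ge> 1 \<Longrightarrow> \<exists>R. achievable_u K a b M R \<and> R \<le> T + C / real n"
  shows "Rstar_u K a b M = T"
  unfolding Rstar_u_def
proof (rule cInf_eq_non_empty)
  show "{R. achievable_u K a b M R} \<noteq> {}" using upper[of 1] by auto
  fix y assume y: "\<And>x. x \<in> {R. achievable_u K a b M R} \<Longrightarrow> y \<le> x"
  have "y \<le> T + C * inverse (real n)" if "n \<ge> 1" for n
    using upper[OF that] y by (force simp: divide_inverse)
  moreover have "(\<lambda>n. T + C * inverse (real n)) \<longlonglongrightarrow> T + C * 0"
    by (intro tendsto_intros lim_inverse_n)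
  ultimately show "y \<le> T" by (intro LIMSEQ_le_const) auto
qed (use lower in auto)

lemma scaled_floor:
  assumes "0 \<le> x" "x \<le> 1"
  obtains m where "m \<le> n" "real m \<le> x * real n" "x * real n - 1 \<le> real m"
proof
  let ?m = "nat \<lfloor>x * real n\<rfloor>"
  have 0: "0 \<le> x * real n" using assms by simp
  then have eq: "real ?m = of_int \<lfloor>x * real n\<rfloor>" by simp
  show "real ?m \<le> x * real n" "x * real n - 1 \<le> real ?m" unfolding eq by linarith+
  moreover have "x * real n \<le> real n" using assms mult_right_mono[of x 1 "real n"] by simp
  ultimately show "?m \<le> n" by linarith
qed

text \<open>Time-sharing: a fraction \<open>x\<close> of each file is cached by all interested users
  and a fraction \<open>z\<close> is split into halves. The load
  \<open>(K - 1) * z / 2 + K * (1 - x - z)\<close> equals \<open>T\<close>.\<close>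

lemma Rstar_u_eqI_split:
  assumes "K \<ge> 2" "0 \<le> x" "0 \<le> z" "x + z \<le> 1"
    and mem: "(2 * real a + real b) * x + (real a + real b) * z \<le> M"
    and T: "T = real K - real K * x - (real K + 1) / 2 * z"
    and lower: "\<And>R. achievable_u K a b M R \<Longrightarrow> T \<le> R"
  shows "Rstar_u K a b M = T"
proof (rule Rstar_u_eqI[OF lower])
  fix n :: nat assume n: "n \<ge> 1"
  obtain m where m: "m \<le> n" "real m \<le> x * real n" "x * real n - 1 \<le> real m"
    using scaled_floor[of x n] assms by auto
  obtain q where q: "q \<le> n" "real q \<le> z * real n" "z * real n - 1 \<le> real q"
    using scaled_floor[of z n] assms by auto
  have "(x + z) * real n \<le> 1 * real n" using assms by (intro mult_right_mono) auto
  then have "real m + real q \<le> real n" using m q by (simp add: algebra_simps)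
  then have mq: "m + q \<le> n" by linarith
  \<comment> \<open>Files have \<open>2 * n\<close> bits, of which \<open>2 * m\<close> are fully
    cached and \<open>2 * q\<close> are split evenly. Rounding \<open>m\<close> and \<open>q\<close>
    down respects the memory; the bits lost go to the uncached part.\<close>
  define r where "r = 2 * n - 2 * m - 2 * q"
  have B: "2 * m + 2 * q + r = 2 * n" using mq by (simp add: r_def)
  have r: "real r = 2 * real n - 2 * real m - 2 * real q" using mq by (simp add: r_def of_nat_diff)
  have "(2 * real a + real b) * real (2 * m) + 2 * (real a + real b) * real q
      \<le> (2 * real a + real b) * (2 * (x * real n)) + 2 * (real a + real b) * (z * real n)"
    using m q by (intro add_mono mult_left_mono) auto
  also have "\<dots> = ((2 * real a + real b) * x + (real a + real b) * z) * real (2 * n)"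
    by (simp add: algebra_simps)
  also have "\<dots> \<le> M * real (2 * n)" using mem by (intro mult_right_mono) auto
  finally have "achievable_u K a b M (((real K - 1) * real q + real K * real r) / real (2 * n))"
    using achievable_split[of K "2 * m" q r a b M] assms(1) n unfolding B by auto
  \<comment> \<open>Rounding costs at most \<open>2 * K\<close> through \<open>m\<close> and
    \<open>K + 1\<close> through \<open>q\<close>, before division by \<open>2 * n\<close>.\<close>
  moreover have "((real K - 1) * real q + real K * real r) / real (2 * n) \<le> T + (3 * real K + 1) / 2 / real n"
  proof -
    have "2 * real K * (x * real n - 1) \<le> 2 * real K * real m"
      using m by (intro mult_left_mono) auto
    moreover have "(real K + 1) * (z * real n - 1) \<le> (real K + 1) * real q"
      using q by (intro mult_left_mono) auto
    moreover have "2 * T = 2 * real K - 2 * real K * x - (real K + 1) * z" unfolding T by simp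
    then have "2 * real n * T = real n * (2 * real K - 2 * real K * x - (real K + 1) * z)" by simp
    ultimately have "(real K - 1) * real q + real K * real r \<le> 2 * real n * T + (3 * real K + 1)"
      unfolding r by (simp add: algebra_simps)
    then have "((real K - 1) * real q + real K * real r) / real (2 * n)
        \<le> (2 * real n * T + (3 * real K + 1)) / real (2 * n)" by (intro divide_right_mono) auto
    also have "\<dots> = T + (3 * real K + 1) / 2 / real n" using n by (simp add: add_divide_distrib)
    finally show ?thesis .
  qed
  ultimately show "\<exists>R. achievable_u K a b M R \<and> R \<le> T + (3 * real K + 1) / 2 / real n" by blast
qed

theorem theorem1:
  fixes K a b :: nat and M :: real
  assumes "K \<ge> 2" and "a \<ge> 1" and "b \<ge> 1"
    and "0 \<le> M" and "M \<le> 2 * real a + real b"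
  shows "(b * (K - 1) < 2 * a \<longrightarrow>
           Rstar_u K a b M =
             (if M \<le> real a + real b
              then real K - (real K + 1) / (2 * (real a + real b)) * M
              else (real K - 1) * (2 * real a + real b) / (2 * real a)
                   - (real K - 1) / (2 * real a) * M))
       \<and> (b * (K - 1) \<ge> 2 * a \<longrightarrow>
           Rstar_u K a b M = real K - real K / (2 * real a + real b) * M)"
proof (intro conjI impI)
  assume "b * (K - 1) < 2 * a"
  then have "real (b * (K - 1)) \<le> real (2 * a)" by (simp only: of_nat_le_iff)
  then have reg: "real b * (real K - 1) \<le> 2 * real a" using assms(1) by (simp add: of_nat_diff)
  note lower = converse_common_regime[OF assms(1-3) _ reg]
  have pos: "real a > 0" "real b > 0" using assms by auto
  show "Rstar_u K a b M =
             (if M \<le> real a + real b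
              then real K - (real K + 1) / (2 * (real a + real b)) * M
              else (real K - 1) * (2 * real a + real b) / (2 * real a)
                   - (real K - 1) / (2 * real a) * M)"
  proof (cases "M \<le> real a + real b")
    case True
    \<comment> \<open>Share between no caching and the split placement, which takes memory
      \<open>a + b\<close>.\<close>
    have "Rstar_u K a b M = real K - (real K + 1) / (2 * (real a + real b)) * M"
      by (rule Rstar_u_eqI_split[where x = 0 and z = "M / (real a + real b)"])
         (use assms pos True lower(1) in \<open>auto simp: field_simps\<close>)
    then show ?thesis using True by simp
  next
    case False
    \<comment> \<open>Share between the split placement and full caching at memory
      \<open>2 * a + b\<close>; \<open>x\<close> is the weight of the latter.\<close>
    define x where "x = (M - real a - real b) / real a"
    have x: "M = real a * x + real a + real b" using pos by (simp add: x_def)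
    have "Rstar_u K a b M = (real K - 1) * (2 * real a + real b) / (2 * real a)
                   - (real K - 1) / (2 * real a) * M"
    proof (rule Rstar_u_eqI_split[where x = x and z = "1 - x"])
      show "0 \<le> x" "0 \<le> 1 - x" using assms pos False by (auto simp: x_def field_simps)
      show "(2 * real a + real b) * x + (real a + real b) * (1 - x) \<le> M"
        by (simp add: x algebra_simps)
      show "(real K - 1) * (2 * real a + real b) / (2 * real a) - (real K - 1) / (2 * real a) * M
          = real K - real K * x - (real K + 1) / 2 * (1 - x)"
        using pos by (simp add: x field_simps)
    qed (use assms lower(2) in auto)
    then show ?thesis using False by simp
  qed
next
  assume "2 * a \<le> b * (K - 1)"
  then have "real (2 * a) \<le> real (b * (K - 1))" by (simp only: of_nat_le_iff)
  then have reg: "2 * real a \<le> real b * (real K - 1)" using assms(1) by (simp add: of_nat_diff)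
  have pos: "2 * real a + real b > 0" using assms by auto
  \<comment> \<open>Only no caching and full caching are mixed here.\<close>
  show "Rstar_u K a b M = real K - real K / (2 * real a + real b) * M"
    by (rule Rstar_u_eqI_split[where x = "M / (2 * real a + real b)" and z = 0])
       (use assms pos converse_private_regime[OF assms(1-3) _ reg] in \<open>auto simp: pos_divide_le_eq\<close>)
qed

end
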